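(* Let $d\ge2$ be an integer and let $L\in\mathbb{N}_0$. For all functions $f\in C^{L+1}(\mathbb{S}^{d-1})$ and for all centers $y\in\mathbb{S}^{d-1}$, the error of the local best approximation of $f$ on the spherical cap $C_\delta(y)$ with respect to the ansatz space $\widetilde{\mathcal{P}}_L(\mathbb{R}^{d-1},\pi,y)$ of polynomials on the tangent space satisfies $$E_\delta\big(\widetilde{\mathcal{P}}_L(\mathbb{R}^{d-1},\pi,y),f,y\big)=\mathcal{O}(\delta^{L+1})\qquad\text{as }\delta\to0 .$$
   Context: $\mathbb{S}^{d-1}=\{y\in\mathbb{R}^d : \|y\|_2=1\}$, $e_d=(0,\dots,0,1)$. Functions take values in $\mathbb{K}\in\{\mathbb{R},\mathbb{C}\}$, and all polynomial and function spaces are linear over the field $\mathbb{K}$ that $f$ maps into. The great circle distance is $d(y,z)=\arccos(\langle y,z\rangle)$, $C_\delta(y)=\{z\in\mathbb{S}^{d-1} : d(y,z)<\delta\}$, and $E_\delta(\mathcal{G},f,y)=\inf_{g\in\mathcal{G}}\sup_{z\in C_\delta(y)}|f(z)-g(z)|$. $\mathcal{P}_L(\mathbb{R}^{d-1})$ is the space of polynomials on $\mathbb{R}^{d-1}$ of total degree at most $L$. The projection $\pi\colon B_1(0)\to C_{\pi/2}(e_d)$, with $B_1(0)\subset\mathbb{R}^{d-1}$ the open unit ball, is $\pi(x_1,\dots,x_{d-1})=(x_1,\dots,x_{d-1},\sqrt{1-\|x\|_2^2})$, with inverse $\pi^{-1}(y_1,\dots,y_d)=(y_1,\dots,y_{d-1})$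 on $C_{\pi/2}(e_d)$. For $y\in\mathbb{S}^{d-1}$ let $\mathbf{R}_y\in\mathcal{SO}(d)$ be a rotation matrix with $\mathbf{R}_y y=e_d$; then $\widetilde{\mathcal{P}}_L(\mathbb{R}^{d-1},\pi,y)=\{p\circ\pi^{-1}\circ\mathbf{R}_y : p\in\mathcal{P}_L(\mathbb{R}^{d-1})\}$, a space of functions on $C_{\pi/2}(y)$ (which does not depend on the particular choice of $\mathbf{R}_y$). $E_\delta$ with this space is considered for $\delta\le\pi/2$. *)

theory Defs
  imports "HOL-Analysis.Analysis" "HOL-Library.Landau_Symbols"
begin

text \<open>
  The dimension \<open>d \<ge> 2\<close> is encoded by an arbitrary finite index type \<open>'n\<close> with
  \<open>d - 1 = CARD('n)\<close> elements: \<open>\<real>\<^bsup>d-1\<^esup>\<close> is \<^typ>\<open>real^'n\<close> and \<open>\<real>\<^sup>d\<close> is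
  \<^typ>\<open>real^('n option)\<close>, where \<^term>\<open>Some i\<close> indexes the first \<open>d - 1\<close> coordinates
  and \<^term>\<open>None\<close> the last one.  Functions on (parts of) the sphere are total
  functions on \<open>\<real>\<^sup>d\<close> of which only the values on the sphere matter.
\<close>

definition e_last :: "real^('n::finite option)"
  where "e_last = axis None 1"

definition cap :: "real \<Rightarrow> 'a::euclidean_space \<Rightarrow> 'a set"
  where "cap \<delta> y = {z \<in> sphere 0 1. arccos (y \<bullet> z) < \<delta>}"

text \<open>
  The supremum and infimum are taken in \<open>\<real>\<close>; they are the intended ones whenever
  all \<open>f - g\<close> with \<open>g \<in> G\<close> are bounded on the nonempty cap.  This is the case below:
  \<open>f\<close> is continuous on the compact sphere and the ansatz functions are bounded on the
  sphere.
\<close>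
definition best_approx_error ::
    "real \<Rightarrow> ('a::euclidean_space \<Rightarrow> 'k::real_normed_field) set \<Rightarrow> ('a \<Rightarrow> 'k) \<Rightarrow> 'a \<Rightarrow> real"
  where "best_approx_error \<delta> G f y = (INF g\<in>G. SUP z\<in>cap \<delta> y. norm (f z - g z))"

definition poly_space :: "nat \<Rightarrow> (real^'n::finite \<Rightarrow> 'k::real_normed_field) set"
  where "poly_space L =
    {p. \<exists>c :: ('n \<Rightarrow> nat) \<Rightarrow> 'k.
      p = (\<lambda>x. \<Sum>\<alpha> | sum \<alpha> UNIV \<le> L. c \<alpha> * (\<Prod>i\<in>UNIV. of_real (x $ i) ^ \<alpha> i))}"

lemma finite_multiindices: "finite {\<alpha> :: 'n::finite \<Rightarrow> nat. sum \<alpha> UNIV \<le> L}"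
proof (rule finite_subset)
  show "{\<alpha> :: 'n \<Rightarrow> nat. sum \<alpha> UNIV \<le> L} \<subseteq> (UNIV \<rightarrow>\<^sub>E {..L})"
    by (auto simp: PiE_def) (meson finite member_le_sum UNIV_I order_trans zero_le)
  show "finite ((UNIV :: 'n set) \<rightarrow>\<^sub>E {..L})"
    by (intro finite_PiE) auto
qed

definition hemi_proj :: "real^'n::finite \<Rightarrow> real^('n option)"
  where "hemi_proj x = (\<chi> j. case j of Some i \<Rightarrow> x $ i | None \<Rightarrow> sqrt (1 - (norm x)\<^sup>2))"

definition hemi_proj_inv :: "real^('n::finite option) \<Rightarrow> real^'n"
  where "hemi_proj_inv y = (\<chi> i. y $ Some i)"

lemma norm_option_sq:
  fixes y :: "real^('n::finite option)"
  shows "(norm y)\<^sup>2 = (norm (hemi_proj_inv y))\<^sup>2 + (y $ None)\<^sup>2"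
proof -
  have "(\<Sum>j\<in>UNIV. (y $ j)\<^sup>2) = (y $ None)\<^sup>2 + (\<Sum>i\<in>UNIV. (y $ Some i)\<^sup>2)"
    by (simp add: UNIV_option_conv sum.reindex)
  then show ?thesis
    by (simp add: norm_vec_def L2_set_def sum_nonneg hemi_proj_inv_def)
qed

lemma cap_pi_half: "cap (pi/2) (e_last :: real^('n::finite option)) = {z \<in> sphere 0 1. 0 < z $ None}"
proof -
  have "arccos (e_last \<bullet> z) < pi/2 \<longleftrightarrow> 0 < z $ None" if "norm z = 1" for z :: "real^('n option)"
  proof -
    have 1: "\<bar>z $ None\<bar> \<le> 1"
      using component_le_norm_cart[of z None] that by simp
    have "arccos (z $ None) < arccos 0 \<longleftrightarrow> 0 < z $ None"
      by (intro arccos_less_mono) (use 1 in auto)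
    then show ?thesis
      by (simp add: e_last_def inner_axis')
  qed
  then show ?thesis
    by (auto simp: cap_def)
qed

lemma bij_betw_hemi_proj:
  "bij_betw hemi_proj (ball 0 1) (cap (pi/2) (e_last :: real^('n::finite option)))"
  "\<And>x :: real^'n. hemi_proj_inv (hemi_proj x) = x"
proof -
  show inv: "hemi_proj_inv (hemi_proj x) = x" for x :: "real^'n"
    by (simp add: hemi_proj_inv_def hemi_proj_def vec_eq_iff)
  show "bij_betw hemi_proj (ball 0 1) (cap (pi/2) (e_last :: real^('n option)))"
  proof (rule bij_betw_byWitness[where f' = hemi_proj_inv])
    show "\<forall>x\<in>ball 0 1. hemi_proj_inv (hemi_proj x) = (x :: real^'n)"
      by (simp add: inv)
    show "\<forall>y\<in>cap (pi/2) e_last. hemi_proj (hemi_proj_inv y) = (y :: real^('n option))"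
    proof
      fix y :: "real^('n option)" assume y: "y \<in> cap (pi/2) e_last"
      then have "1 - (norm (hemi_proj_inv y))\<^sup>2 = (y $ None)\<^sup>2" "0 < y $ None"
        using norm_option_sq[of y] by (auto simp: cap_pi_half)
      then have "sqrt (1 - (norm (hemi_proj_inv y))\<^sup>2) = y $ None"
        by simp
      then show "hemi_proj (hemi_proj_inv y) = y"
        by (auto simp: hemi_proj_def hemi_proj_inv_def vec_eq_iff split: option.splits)
    qed
    show "hemi_proj ` ball 0 1 \<subseteq> cap (pi/2) (e_last :: real^('n option))"
    proof clarify
      fix x :: "real^'n" assume "x \<in> ball 0 1"
      then have lt: "(norm x)\<^sup>2 < 1"
        by (simp add: power_less_one_iff abs_square_less_1)
      have last: "hemi_proj x $ None = sqrt (1 - (norm x)\<^sup>2)"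
        by (simp add: hemi_proj_def)
      have "(norm (hemi_proj x))\<^sup>2 = 1"
        using lt unfolding norm_option_sq inv last by simp
      then have "norm (hemi_proj x) = 1"
        by (simp add: power2_eq_1_iff) (use norm_ge_zero[of "hemi_proj x"] in linarith)
      then show "hemi_proj x \<in> cap (pi/2) e_last"
        using lt by (simp add: cap_pi_half last)
    qed
    show "hemi_proj_inv ` cap (pi/2) (e_last :: real^('n option)) \<subseteq> ball 0 1"
    proof clarify
      fix y :: "real^('n option)" assume "y \<in> cap (pi/2) e_last"
      then have "(norm (hemi_proj_inv y))\<^sup>2 + (y $ None)\<^sup>2 = 1" "0 < y $ None"
        using norm_option_sq[of y] by (auto simp: cap_pi_half)
      then have "(norm (hemi_proj_inv y))\<^sup>2 < 1"
        using zero_less_power[of "y $ None" 2] by linarith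
      then show "hemi_proj_inv y \<in> ball 0 1"
        by (simp add: abs_square_less_1)
    qed
  qed
qed

text \<open>
  The ansatz space at \<open>y\<close>, with the chosen rotation \<open>R = R\<^sub>y\<close>, \<open>R y = e\<^sub>d\<close>, as parameter.
\<close>
definition tangent_poly_space ::
    "nat \<Rightarrow> real^('n::finite option)^('n option) \<Rightarrow> (real^('n option) \<Rightarrow> 'k::real_normed_field) set"
  where "tangent_poly_space L R = {p \<circ> hemi_proj_inv \<circ> (*v) R | p. p \<in> poly_space L}"

lemma rotation_to_e_last_exists:
  fixes y :: "real^('n::finite option)"
  assumes "y \<in> sphere 0 1"
  shows "\<exists>R. rotation_matrix R \<and> R *v y = e_last"
proof -
  have "2 \<le> CARD('n option)"
    by (simp add: Suc_leI)
  moreover have "norm y = 1"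
    using assms by simp
  ultimately obtain A :: "real^('n option)^('n option)"
    where A: "rotation_matrix A" "A *v axis None 1 = y"
    by (rule rotation_matrix_exists_basis)
  have "rotation_matrix (transpose A)"
    using A(1) by (simp add: rotation_matrix_def)
  moreover have "transpose A *v y = e_last"
    using A unfolding rotation_matrix_def orthogonal_matrix_def e_last_def
    by (metis matrix_vector_mul_assoc matrix_vector_mul_lid)
  ultimately show ?thesis
    by blast
qed

text \<open>
  \<open>C\<^sup>k\<close> on an open set \<open>U\<close>: the iterated directional derivatives of order below \<open>k\<close>
  are Frechet differentiable and those of order \<open>k\<close> are continuous.
  For complex-valued functions this is real differentiability.
\<close>
primrec Ck_on ::
    "nat \<Rightarrow> 'a::real_normed_vector set \<Rightarrow> ('a \<Rightarrow> 'b::real_normed_vector) \<Rightarrow> bool"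
  where
    "Ck_on 0 U f \<longleftrightarrow> continuous_on U f"
  | "Ck_on (Suc k) U f \<longleftrightarrow> (\<forall>x\<in>U. f differentiable (at x)) \<and>
      (\<forall>v. Ck_on k U (\<lambda>x. frechet_derivative f (at x) v))"

text \<open>
  \<open>C\<^sup>k\<close> on the sphere as an embedded submanifold: locally the restriction of a \<open>C\<^sup>k\<close>
  function on an open subset of the ambient space.
\<close>
definition Ck_sphere :: "nat \<Rightarrow> ('a::euclidean_space \<Rightarrow> 'k::real_normed_vector) \<Rightarrow> bool"
  where "Ck_sphere k f \<longleftrightarrow>
    (\<forall>x\<in>sphere 0 1. \<exists>U F. open U \<and> x \<in> U \<and> Ck_on k U F \<and> (\<forall>z\<in>U \<inter> sphere 0 1. F z = f z))"

end

theory Submission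
  imports Defs
begin

text \<open>
  In ambient coordinates, Taylor's theorem approximates a local extension of \<open>f\<close> at \<open>y\<close> by a
  polynomial in \<open>z - y\<close>.  In the tangent coordinate \<open>x\<close> of \<open>z\<close>, the components of \<open>z - y\<close> are
  linear combinations of the \<open>x\<^sub>i\<close> and of \<open>w = 1 - sqrt (1 - |x|\<^sup>2)\<close>.  Since
  \<open>w = (|x|\<^sup>2 + w\<^sup>2) / 2\<close>, a polynomial approximation of \<open>w\<close> up to \<open>O(|x|\<^sup>k)\<close> improves itself to one
  up to \<open>O(|x|\<^bsup>k+1\<^esup>)\<close>.  Hence \<open>f\<close> agrees with a polynomial in \<open>x\<close> up to \<open>O(|x|\<^bsup>L+1\<^esup>)\<close>; dropping its
  terms of degree above \<open>L\<close> keeps this order, and \<open>|x| \<le> \<delta>\<close> on the cap.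
\<close>

section \<open>Taylor expansion with homogeneous terms\<close>

text \<open>Generated by linear functionals \<open>x \<bullet> v\<close> with arbitrary
  \<open>v\<close>, so that scalar factors can be absorbed into \<open>v\<close> and coefficients
  may lie in any real vector space. The rules give the induction that later substitutes tangent
  coordinates.\<close>

inductive hom_poly :: "nat \<Rightarrow> ('a::euclidean_space \<Rightarrow> 'b::real_vector) \<Rightarrow> bool" where
  hom_poly_const: "hom_poly 0 (\<lambda>_. c)"
| hom_poly_add: "hom_poly k p \<Longrightarrow> hom_poly k q \<Longrightarrow> hom_poly k (\<lambda>x. p x + q x)"
| hom_poly_inner: "hom_poly k p \<Longrightarrow> hom_poly (Suc k) (\<lambda>x. (x \<bullet> v) *\<^sub>R p x)"

lemma hom_poly_zero: "hom_poly k (\<lambda>_. 0)"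
proof (induction k)
  case 0
  show ?case by (rule hom_poly_const)
next
  case (Suc k)
  from hom_poly_inner[OF this, of 0] show ?case by simp
qed

lemma hom_poly_sum:
  assumes "\<And>i. i \<in> I \<Longrightarrow> hom_poly k (p i)"
  shows "hom_poly k (\<lambda>x. \<Sum>i\<in>I. p i x)"
  using assms
  by (induction I rule: infinite_finite_induct) (auto intro: hom_poly_zero hom_poly_add)

text \<open>Homogeneity turns the Taylor terms along the ray \<open>t *\<^sub>R h\<close> into
  powers of \<open>t\<close>.\<close>

lemma hom_poly_scaleR:
  assumes "hom_poly k p"
  shows "p (t *\<^sub>R x) = t ^ k *\<^sub>R p x"
  using assms by induction (auto simp: algebra_simps)

text \<open>Induction on the order: the derivatives along \<open>Basis\<close> are expanded by the
  induction hypothesis, and the mean value inequality on the segment from \<open>y\<close> to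
  \<open>y + h\<close> gains one power of \<open>norm h\<close>. The base case is local boundedness
  of a continuous function. The filter \<open>nhds 0\<close> includes \<open>h = 0\<close>, so the
  bounds hold on full balls.\<close>

theorem Ck_on_taylor:
  fixes F :: "'a::euclidean_space \<Rightarrow> 'b::real_normed_vector"
  assumes "open U" "y \<in> U" "Ck_on m U F"
  shows "\<exists>P. (\<forall>k. hom_poly k (P k)) \<and>
    (\<lambda>h. norm (F (y + h) - (\<Sum>k<m. P k h))) \<in> O[nhds 0](\<lambda>h. norm h ^ m)"
  using assms(3)
proof (induction m arbitrary: F)
  case 0
  then have "isCont F y"
    using assms by (simp add: continuous_on_eq_continuous_at)
  then have "(\<lambda>h. F (y + h)) \<midarrow>0\<rightarrow> F y"
    by (simp add: isCont_def LIM_offset_zero_iff)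
  then have "((\<lambda>h. F (y + h)) \<longlongrightarrow> F (y + 0)) (nhds 0)"
    by (subst tendsto_nhds_iff) simp
  from tendsto_norm[OF this]
  have "eventually (\<lambda>h. norm (F (y + h)) < norm (F y) + 1) (nhds 0)"
    by (rule order_tendstoD) simp
  then have "(\<lambda>h. norm (F (y + h))) \<in> O[nhds 0](\<lambda>_. 1)"
    by (intro bigoI[where c = "norm (F y) + 1"]) (auto elim!: eventually_mono)
  then show ?case
    by (intro exI[of _ "\<lambda>_ _. 0"]) (simp add: hom_poly_zero)
next
  case (Suc m)
  define G where "G v x = frechet_derivative F (at x) v" for v x
  have derF: "(F has_derivative (\<lambda>v. G v x)) (at x)" if "x \<in> U" for x
    using Suc.prems that by (simp add: G_def frechet_derivative_works)
  have "\<forall>b. \<exists>P. (\<forall>k. hom_poly k (P k)) \<and>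
      (\<lambda>h. norm (G b (y + h) - (\<Sum>k<m. P k h))) \<in> O[nhds 0](\<lambda>h. norm h ^ m)"
    unfolding G_def
  proof
    fix b
    show "\<exists>P. (\<forall>k. hom_poly k (P k)) \<and>
      (\<lambda>h. norm (frechet_derivative F (at (y + h)) b - (\<Sum>k<m. P k h))) \<in> O[nhds 0](\<lambda>h. norm h ^ m)"
      using Suc.prems by (intro Suc.IH) simp
  qed
  then obtain P where P: "\<And>b k. hom_poly k (P b k)"
    "\<And>b. (\<lambda>h. norm (G b (y + h) - (\<Sum>k<m. P b k h))) \<in> O[nhds 0](\<lambda>h. norm h ^ m)"
    by metis
  from P(2) have "\<forall>b. \<exists>c>0. eventually (\<lambda>h. norm (G b (y + h) - (\<Sum>k<m. P b k h)) \<le> c * norm h ^ m) (nhds 0)"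
    unfolding bigo_def by simp
  from choice[OF this] obtain c where c: "\<And>b. c b > 0"
    "\<And>b. eventually (\<lambda>h. norm (G b (y + h) - (\<Sum>k<m. P b k h)) \<le> c b * norm h ^ m) (nhds 0)"
    by blast
  define C where "C = (\<Sum>b\<in>Basis. c b)"
  have "((\<lambda>h. y + h) \<longlongrightarrow> y + 0) (nhds 0)"
    by (intro tendsto_intros filterlim_ident)
  then have "eventually (\<lambda>h. y + h \<in> U) (nhds 0)"
    using assms by (intro topological_tendstoD) auto
  moreover have "eventually (\<lambda>h. \<forall>b\<in>Basis. norm (G b (y + h) - (\<Sum>k<m. P b k h)) \<le> c b * norm h ^ m) (nhds 0)"
    using c(2) by (subst eventually_ball_finite_distrib) auto
  ultimately have "eventually (\<lambda>h. y + h \<in> U \<and>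
      (\<forall>b\<in>Basis. norm (G b (y + h) - (\<Sum>k<m. P b k h)) \<le> c b * norm h ^ m)) (nhds 0)"
    by (rule eventually_conj)
  then obtain e where e: "e > 0" "\<And>h. norm h < e \<Longrightarrow> y + h \<in> U"
    "\<And>h b. norm h < e \<Longrightarrow> b \<in> Basis \<Longrightarrow> norm (G b (y + h) - (\<Sum>k<m. P b k h)) \<le> c b * norm h ^ m"
    by (auto simp: eventually_nhds_metric dist_norm)
  \<comment> \<open>The factor \<open>1 / Suc k\<close> comes from integrating \<open>t ^ k\<close>
    over the unit interval; it sits inside the inner product to fit
    \<open>hom_poly_inner\<close>.\<close>
  define Q where "Q k h = (\<Sum>b\<in>Basis. (h \<bullet> (b /\<^sub>R real (Suc k))) *\<^sub>R P b k h)" for k h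
  have homQ: "hom_poly (Suc k) (Q k)" for k
    unfolding Q_def by (intro hom_poly_sum hom_poly_inner P)
  have bound: "norm (F (y + h) - (F y + (\<Sum>k<m. Q k h))) \<le> C * norm h ^ Suc m" if h: "norm h < e" for h
  proof -
    \<comment> \<open>The remainder along the segment up to the constant \<open>F y\<close>, which
      is recovered as \<open>\<phi> 0\<close>.\<close>
    define \<phi> where "\<phi> t = F (y + t *\<^sub>R h) - (\<Sum>k<m. t ^ Suc k *\<^sub>R Q k h)" for t
    define \<phi>' where "\<phi>' t = G h (y + t *\<^sub>R h) - (\<Sum>k<m. (real (Suc k) * t ^ k) *\<^sub>R Q k h)" for t
    have small: "norm (t *\<^sub>R h) \<le> norm h" if "t \<in> {0..1}" for t
      using that by (auto intro: mult_left_le_one_le)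
    have der: "(\<phi> has_vector_derivative \<phi>' t) (at t within {0..1})" if t: "t \<in> {0..1}" for t
    proof -
      have U: "y + t *\<^sub>R h \<in> U"
        using small[OF t] h by (intro e) simp
      have 1: "((\<lambda>t. y + t *\<^sub>R h) has_derivative (\<lambda>s. s *\<^sub>R h)) (at t within {0..1})"
        by (auto intro!: derivative_eq_intros)
      have "((\<lambda>t. F (y + t *\<^sub>R h)) has_derivative (\<lambda>s. G (s *\<^sub>R h) (y + t *\<^sub>R h))) (at t within {0..1})"
        using has_derivative_compose[OF 1 derF[OF U]] .
      moreover have "G (s *\<^sub>R h) (y + t *\<^sub>R h) = s *\<^sub>R G h (y + t *\<^sub>R h)" for s
        using linear_scale[OF has_derivative_linear[OF derF[OF U]]] .
      ultimately have 2: "((\<lambda>t. F (y + t *\<^sub>R h)) has_vector_derivative G h (y + t *\<^sub>R h)) (at t within {0..1})"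
        by (simp add: has_vector_derivative_def)
      have 3: "((\<lambda>t. t ^ Suc k *\<^sub>R Q k h) has_vector_derivative (real (Suc k) * t ^ k) *\<^sub>R Q k h) (at t within {0..1})" for k
      proof -
        have "((\<lambda>t::real. t ^ Suc k) has_field_derivative real (Suc k) * t ^ k) (at t within {0..1})"
          by (rule derivative_eq_intros refl | simp)+
        from has_vector_derivative_scaleR[OF this has_vector_derivative_const[of "Q k h"]]
        show ?thesis by simp
      qed
      show ?thesis
        unfolding \<phi>_def \<phi>'_def
        by (intro has_vector_derivative_diff 2 has_vector_derivative_sum 3)
    qed
    \<comment> \<open>By linearity in \<open>h\<close> and homogeneity, \<open>\<phi>' t\<close> is
      a combination of the errors of the induction hypothesis at \<open>t *\<^sub>R h\<close>; the
      coefficients \<open>h \<bullet> b\<close> supply the extra power.\<close>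
    have bd: "norm (\<phi>' t) \<le> C * norm h ^ Suc m" if t: "t \<in> {0..1}" for t
    proof -
      have th: "norm (t *\<^sub>R h) < e"
        using small[OF t] h by simp
      have "G h (y + t *\<^sub>R h) = (\<Sum>b\<in>Basis. (h \<bullet> b) *\<^sub>R G b (y + t *\<^sub>R h))"
        by (subst euclidean_representation[of h, symmetric],
            subst linear_sum[OF has_derivative_linear[OF derF[OF e(2)[OF th]]]],
            subst linear_scale[OF has_derivative_linear[OF derF[OF e(2)[OF th]]]]) simp
      moreover have "(real (Suc k) * t ^ k) *\<^sub>R Q k h = (\<Sum>b\<in>Basis. (h \<bullet> b) *\<^sub>R P b k (t *\<^sub>R h))" for k
        unfolding Q_def scaleR_sum_right hom_poly_scaleR[OF P(1)] by (simp add: field_simps del: of_nat_Suc)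
      ultimately have "\<phi>' t = (\<Sum>b\<in>Basis. (h \<bullet> b) *\<^sub>R G b (y + t *\<^sub>R h)) -
          (\<Sum>k<m. \<Sum>b\<in>Basis. (h \<bullet> b) *\<^sub>R P b k (t *\<^sub>R h))"
        unfolding \<phi>'_def by (simp only:)
      also have "\<dots> = (\<Sum>b\<in>Basis. (h \<bullet> b) *\<^sub>R (G b (y + t *\<^sub>R h) - (\<Sum>k<m. P b k (t *\<^sub>R h))))"
        by (subst sum.swap) (simp only: scaleR_diff_right sum_subtractf scaleR_sum_right)
      finally have "\<phi>' t = (\<Sum>b\<in>Basis. (h \<bullet> b) *\<^sub>R (G b (y + t *\<^sub>R h) - (\<Sum>k<m. P b k (t *\<^sub>R h))))" .
      also have "norm \<dots> \<le> (\<Sum>b\<in>Basis. norm h * (c b * norm h ^ m))"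
      proof (rule sum_norm_le)
        fix b :: 'a assume b: "b \<in> Basis"
        have "norm (G b (y + t *\<^sub>R h) - (\<Sum>k<m. P b k (t *\<^sub>R h))) \<le> c b * norm (t *\<^sub>R h) ^ m"
          by (rule e(3)[OF th b])
        also have "\<dots> \<le> c b * norm h ^ m"
          using small[OF t] c(1)[of b] by (intro mult_left_mono power_mono) auto
        finally show "norm ((h \<bullet> b) *\<^sub>R (G b (y + t *\<^sub>R h) - (\<Sum>k<m. P b k (t *\<^sub>R h)))) \<le> norm h * (c b * norm h ^ m)"
          using Basis_le_norm[OF b, of h] by (simp add: mult_mono)
      qed
      also have "\<dots> = C * norm h ^ Suc m"
        by (simp add: C_def sum_distrib_right sum_distrib_left mult_ac)
      finally show ?thesis .
    qed
    have "norm (\<phi> 1 - \<phi> 0) \<le> C * norm h ^ Suc m * norm (1 - 0 :: real)"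
    proof (rule differentiable_bound[of "{0..1}" \<phi> "\<lambda>t s. s *\<^sub>R \<phi>' t"])
      fix t :: real assume t: "t \<in> {0..1}"
      show "(\<phi> has_derivative (\<lambda>s. s *\<^sub>R \<phi>' t)) (at t within {0..1})"
        using der[OF t] by (simp add: has_vector_derivative_def)
      show "onorm (\<lambda>s. s *\<^sub>R \<phi>' t) \<le> C * norm h ^ Suc m"
        using bd[OF t] order_trans[OF norm_ge_zero bd[OF t]]
        by (intro onorm_bound) (simp_all add: mult.commute[of _ "\<bar>_\<bar>"] mult_left_mono)
    qed auto
    then show ?thesis
      by (simp add: \<phi>_def algebra_simps)
  qed
  define P' where "P' k = (case k of 0 \<Rightarrow> (\<lambda>_. F y) | Suc j \<Rightarrow> Q j)" for k
  have "hom_poly k (P' k)" for k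
    by (cases k) (auto simp: P'_def homQ intro: hom_poly_const)
  moreover have "(\<Sum>k<Suc m. P' k h) = F y + (\<Sum>k<m. Q k h)" for h
    by (simp add: sum.lessThan_Suc_shift P'_def del: sum.lessThan_Suc)
  moreover have "(\<lambda>h. norm (F (y + h) - (F y + (\<Sum>k<m. Q k h)))) \<in> O[nhds 0](\<lambda>h. norm h ^ Suc m)"
    using bound e(1)
    by (intro bigoI[where c = C]) (auto simp: eventually_nhds_metric dist_norm)
  ultimately show ?case
    by (intro exI[of _ P']) simp
qed

section \<open>Polynomials in several variables\<close>

lemma poly_space_monomial:
  fixes c :: "'k::real_normed_field" and \<alpha> :: "'n::finite \<Rightarrow> nat"
  assumes "sum \<alpha> UNIV \<le> L"
  shows "(\<lambda>x. c * (\<Prod>i\<in>UNIV. of_real (x $ i) ^ \<alpha> i)) \<in> poly_space L"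
  unfolding poly_space_def
  using assms by (auto intro!: exI[of _ "\<lambda>\<beta>. if \<beta> = \<alpha> then c else 0"]
      simp: if_distrib[of "\<lambda>t. t * _"] sum.delta' finite_multiindices cong: if_cong)

lemma poly_space_const: "(\<lambda>_. c) \<in> poly_space L"
  using poly_space_monomial[of "\<lambda>_. 0" L c] by simp

lemma poly_space_coord:
  fixes i :: "'n::finite"
  shows "(\<lambda>x. of_real (x $ i) :: 'k::real_normed_field) \<in> poly_space 1"
proof -
  have "(\<Prod>j\<in>UNIV. of_real (x $ j) ^ (if j = i then 1 else 0)) = (of_real (x $ i) :: 'k)" for x :: "real^'n"
    by (simp add: if_distrib[of "\<lambda>k. _ ^ k"] prod.delta cong: if_cong)
  then show ?thesis
    using poly_space_monomial[of "\<lambda>j. if j = i then 1 else 0" 1 "1 :: 'k"]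
    by (simp only: sum.delta finite UNIV_I mult_1 if_True order_refl TrueI simp_thms)
qed

lemma poly_space_add:
  assumes "p \<in> poly_space L" "q \<in> poly_space L"
  shows "(\<lambda>x. p x + q x) \<in> poly_space L"
proof -
  obtain c d where "p = (\<lambda>x. \<Sum>\<alpha> | sum \<alpha> UNIV \<le> L. c \<alpha> * (\<Prod>i\<in>UNIV. of_real (x $ i) ^ \<alpha> i))"
    "q = (\<lambda>x. \<Sum>\<alpha> | sum \<alpha> UNIV \<le> L. d \<alpha> * (\<Prod>i\<in>UNIV. of_real (x $ i) ^ \<alpha> i))"
    using assms unfolding poly_space_def by auto
  then show ?thesis
    unfolding poly_space_def
    by (auto intro!: exI[of _ "\<lambda>\<alpha>. c \<alpha> + d \<alpha>"] simp: distrib_right sum.distrib)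
qed

lemma poly_space_sum:
  assumes "\<And>i. i \<in> I \<Longrightarrow> p i \<in> poly_space L"
  shows "(\<lambda>x. \<Sum>i\<in>I. p i x) \<in> poly_space L"
  using assms
  by (induction I rule: infinite_finite_induct) (auto intro: poly_space_const poly_space_add)

lemma poly_space_mult:
  assumes "p \<in> poly_space L" "q \<in> poly_space M"
  shows "(\<lambda>x. p x * q x) \<in> poly_space (L + M)"
proof -
  obtain c d where pq: "p = (\<lambda>x. \<Sum>\<alpha> | sum \<alpha> UNIV \<le> L. c \<alpha> * (\<Prod>i\<in>UNIV. of_real (x $ i) ^ \<alpha> i))"
    "q = (\<lambda>x. \<Sum>\<alpha> | sum \<alpha> UNIV \<le> M. d \<alpha> * (\<Prod>i\<in>UNIV. of_real (x $ i) ^ \<alpha> i))"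
    using assms unfolding poly_space_def by auto
  have "p x * q x = (\<Sum>\<alpha> | sum \<alpha> UNIV \<le> L. \<Sum>\<beta> | sum \<beta> UNIV \<le> M.
      (c \<alpha> * d \<beta>) * (\<Prod>i\<in>UNIV. of_real (x $ i) ^ (\<alpha> i + \<beta> i)))" for x
    unfolding pq by (simp add: sum_product power_add prod.distrib mult_ac)
  moreover have "(\<lambda>x. \<Sum>\<alpha> | sum \<alpha> UNIV \<le> L. \<Sum>\<beta> | sum \<beta> UNIV \<le> M.
      (c \<alpha> * d \<beta>) * (\<Prod>i\<in>UNIV. of_real (x $ i) ^ (\<alpha> i + \<beta> i))) \<in> poly_space (L + M)"
    by (intro poly_space_sum poly_space_monomial) (simp add: sum.distrib)
  ultimately show ?thesis by simp
qed

text \<open>Multiplying by the constant 1, read as a polynomial of degree at most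
  \<open>M - L\<close>, avoids reindexing the coefficients.\<close>

lemma poly_space_mono:
  assumes "p \<in> poly_space L" "L \<le> M"
  shows "p \<in> poly_space M"
  using poly_space_mult[OF assms(1) poly_space_const[of 1 "M - L"]] assms(2) by simp

lemma continuous_on_poly_space:
  assumes "p \<in> poly_space L"
  shows "continuous_on S p"
  using assms unfolding poly_space_def by (auto intro!: continuous_intros)

lemma norm_monomial_le:
  fixes x :: "real^'n::finite"
  shows "norm (\<Prod>i\<in>UNIV. of_real (x $ i) ^ \<alpha> i :: 'k::real_normed_field) \<le> norm x ^ sum \<alpha> UNIV"
  unfolding power_sum prod_norm[symmetric]
  by (intro prod_mono) (auto simp: norm_power intro!: power_mono component_le_norm_cart)

text \<open>Powers decrease on the unit ball. Both sides are embedded by \<open>of_real\<close>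
  because a Landau class compares functions with the same codomain.\<close>

lemma bigo_norm_power_mono:
  assumes "m \<le> k"
  shows "(\<lambda>x::'a::real_normed_vector. of_real (norm x ^ k)) \<in> O[nhds 0](\<lambda>x. of_real (norm x ^ m) :: 'k::real_normed_field)"
  using assms
  by (intro bigoI[where c = 1])
    (auto simp: eventually_nhds_metric norm_power intro!: exI[of _ 1] power_decreasing)

text \<open>The discarded monomials have degree at least \<open>Suc L\<close>, so the error absorbs
  them. This brings polynomials of uncontrolled degree back to degree \<open>L\<close>.\<close>

lemma poly_space_truncate:
  fixes p :: "real^'n::finite \<Rightarrow> 'k::real_normed_field"
  assumes "p \<in> poly_space M"
  shows "\<exists>q\<in>poly_space L. (\<lambda>x. p x - q x) \<in> O[nhds 0](\<lambda>x. of_real (norm x ^ Suc L))"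
proof -
  obtain c where p: "p = (\<lambda>x. \<Sum>\<alpha> | sum \<alpha> UNIV \<le> M. c \<alpha> * (\<Prod>i\<in>UNIV. of_real (x $ i) ^ \<alpha> i))"
    using assms unfolding poly_space_def by auto
  define q where "q x = (\<Sum>\<alpha> | sum \<alpha> UNIV \<le> M \<and> sum \<alpha> UNIV \<le> L. c \<alpha> * (\<Prod>i\<in>UNIV. of_real (x $ i) ^ \<alpha> i))" for x
  have "q \<in> poly_space L"
    unfolding q_def by (intro poly_space_sum poly_space_monomial) auto
  moreover have "p x - q x = (\<Sum>\<alpha> | sum \<alpha> UNIV \<le> M \<and> \<not> sum \<alpha> UNIV \<le> L. c \<alpha> * (\<Prod>i\<in>UNIV. of_real (x $ i) ^ \<alpha> i))" for x
    unfolding p q_def using finite_multiindices[of M]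
    by (subst sum_diff[symmetric]) (auto intro!: sum.cong)
  moreover have "(\<lambda>x. c \<alpha> * (\<Prod>i\<in>UNIV. of_real (x $ i) ^ \<alpha> i)) \<in> O[nhds 0](\<lambda>x. of_real (norm x ^ Suc L))"
    if "\<not> sum \<alpha> UNIV \<le> L" for \<alpha>
  proof -
    have "(\<lambda>x. c \<alpha> * (\<Prod>i\<in>UNIV. of_real (x $ i) ^ \<alpha> i)) \<in> O[nhds 0](\<lambda>x. of_real (norm x ^ sum \<alpha> UNIV))"
      by (intro bigoI[where c = "norm (c \<alpha>)"] always_eventually allI)
        (auto simp: norm_mult norm_power intro!: mult_left_mono norm_monomial_le)
    also have "(\<lambda>x::real^'n. of_real (norm x ^ sum \<alpha> UNIV) :: 'k) \<in> O[nhds 0](\<lambda>x. of_real (norm x ^ Suc L))"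
      by (rule bigo_norm_power_mono) (use that in simp)
    finally show ?thesis .
  qed
  then have "(\<lambda>x. \<Sum>\<alpha> | sum \<alpha> UNIV \<le> M \<and> \<not> sum \<alpha> UNIV \<le> L. c \<alpha> * (\<Prod>i\<in>UNIV. of_real (x $ i) ^ \<alpha> i))
      \<in> O[nhds 0](\<lambda>x. of_real (norm x ^ Suc L))"
    by (intro big_sum_in_bigo) auto
  ultimately show ?thesis by (intro bexI[of _ q]) (simp_all only:)
qed

section \<open>Functions with a polynomial expansion at the origin\<close>

text \<open>The degree \<open>M\<close> stays free so that closure under products needs no
  bookkeeping; \<open>poly_space_truncate\<close> restores the degree at the end.\<close>

definition poly_approx :: "nat \<Rightarrow> (real^'n::finite \<Rightarrow> 'k::real_normed_field) \<Rightarrow> bool" where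
  "poly_approx m g \<longleftrightarrow> (\<exists>M. \<exists>p\<in>poly_space M. (\<lambda>x. g x - p x) \<in> O[nhds 0](\<lambda>x. of_real (norm x ^ m)))"

lemma poly_approx_poly: "p \<in> poly_space M \<Longrightarrow> poly_approx m p"
  unfolding poly_approx_def by (intro exI[of _ M] bexI[of _ p]) auto

lemma poly_space_bigo_1:
  fixes p :: "real^'n::finite \<Rightarrow> 'k::real_normed_field"
  assumes "p \<in> poly_space M"
  shows "p \<in> O[nhds 0](\<lambda>_. 1)"
proof -
  obtain B where B: "norm (p x) \<le> B" if "norm x \<le> 1" for x
    using compact_imp_bounded[OF compact_continuous_image[OF continuous_on_poly_space[OF assms] compact_cball[of 0 1]]]
    unfolding bounded_iff by (metis image_eqI mem_cball_0)
  then show ?thesis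
    by (intro bigoI[where c = B]) (auto simp: eventually_nhds_metric intro!: exI[of _ 1])
qed

lemma poly_approx_add:
  assumes "poly_approx m f" "poly_approx m g"
  shows "poly_approx m (\<lambda>x. f x + g x)"
proof -
  obtain M N p q where *: "p \<in> poly_space M" "q \<in> poly_space N"
    "(\<lambda>x. f x - p x) \<in> O[nhds 0](\<lambda>x. of_real (norm x ^ m))"
    "(\<lambda>x. g x - q x) \<in> O[nhds 0](\<lambda>x. of_real (norm x ^ m))"
    using assms unfolding poly_approx_def by auto
  have "(\<lambda>x. p x + q x) \<in> poly_space (M + N)"
    using * by (intro poly_space_add) (auto elim: poly_space_mono)
  moreover have "(\<lambda>x. f x + g x - (p x + q x)) \<in> O[nhds 0](\<lambda>x. of_real (norm x ^ m))"
    using sum_in_bigo(1)[OF *(3,4)] by (simp add: algebra_simps)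
  ultimately show ?thesis
    unfolding poly_approx_def by (intro exI bexI[rotated])
qed

text \<open>Splits \<open>f * g - p * q\<close> as \<open>(f - p) * g + p * (g - q)\<close>, where
  \<open>p\<close> and \<open>g\<close> are bounded near the origin.\<close>

lemma poly_approx_mult:
  fixes f g :: "real^'n::finite \<Rightarrow> 'k::real_normed_field"
  assumes "poly_approx m f" "poly_approx m g"
  shows "poly_approx m (\<lambda>x. f x * g x)"
proof -
  obtain M N p q where *: "p \<in> poly_space M" "q \<in> poly_space N"
    "(\<lambda>x. f x - p x) \<in> O[nhds 0](\<lambda>x. of_real (norm x ^ m))"
    "(\<lambda>x. g x - q x) \<in> O[nhds 0](\<lambda>x. of_real (norm x ^ m))"
    using assms unfolding poly_approx_def by auto
  have "(\<lambda>x. g x - q x) \<in> O[nhds 0](\<lambda>_. 1)"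
    using landau_o.big_trans[OF *(4) bigo_norm_power_mono[of 0 m]] by simp
  from sum_in_bigo(1)[OF this poly_space_bigo_1[OF *(2)]] have g: "g \<in> O[nhds 0](\<lambda>_. 1)"
    by simp
  have "(\<lambda>x. (f x - p x) * g x + p x * (g x - q x)) \<in> O[nhds 0](\<lambda>x. of_real (norm x ^ m))"
    using landau_o.big.mult[OF *(3) g] landau_o.big.mult[OF poly_space_bigo_1[OF *(1)] *(4)]
    by (intro sum_in_bigo(1)) simp_all
  then have "(\<lambda>x. f x * g x - p x * q x) \<in> O[nhds 0](\<lambda>x. of_real (norm x ^ m))"
    by (simp add: algebra_simps)
  with poly_space_mult[OF *(1,2)] show ?thesis
    unfolding poly_approx_def by (intro exI bexI[rotated])
qed

lemma poly_approx_sum: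
  assumes "\<And>i. i \<in> I \<Longrightarrow> poly_approx m (f i)"
  shows "poly_approx m (\<lambda>x. \<Sum>i\<in>I. f i x)"
  using assms
  by (induction I rule: infinite_finite_induct)
    (auto intro: poly_approx_poly[OF poly_space_const[of _ 0]] poly_approx_add)

lemma poly_approx_of_real_norm_sq:
  "poly_approx m (\<lambda>x::real^'n::finite. of_real ((norm x)\<^sup>2) :: 'k::real_normed_field)"
proof -
  have "of_real ((norm x)\<^sup>2) = (\<Sum>i\<in>UNIV. of_real (x $ i) * of_real (x $ i) :: 'k)" for x :: "real^'n"
    by (simp add: norm_vec_def L2_set_def sum_nonneg power2_eq_square)
  then show ?thesis
    by (simp only:) (intro poly_approx_sum poly_approx_mult poly_approx_poly[OF poly_space_coord])
qed

text \<open>The drop of \<open>hemi_proj x\<close> below the pole, the only coordinate of the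
  displacement that is not polynomial in \<open>x\<close>.\<close>

definition height_defect :: "real^'n::finite \<Rightarrow> real" where
  "height_defect x = 1 - sqrt (1 - (norm x)\<^sup>2)"

text \<open>With w the defect, the last identity is
  \<open>(1 - w)\<^sup>2 = 1 - (norm x)\<^sup>2\<close> rearranged. The linear bound rests on
  \<open>(1 - r)\<^sup>2 \<le> 1 - r\<^sup>2\<close> for r between 0 and 1; it starts the
  bootstrapping below.\<close>

lemma height_defect:
  assumes "norm x \<le> 1"
  shows "0 \<le> height_defect x" "height_defect x \<le> norm x"
    "height_defect x = ((norm x)\<^sup>2 + (height_defect x)\<^sup>2) / 2"
proof -
  have le1: "(norm x)\<^sup>2 \<le> 1"
    using assms by (simp add: power_le_one)
  show "0 \<le> height_defect x"
    by (simp add: height_defect_def)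
  have "1 - norm x \<le> sqrt (1 - (norm x)\<^sup>2)"
  proof (rule real_le_rsqrt)
    have "norm x * norm x \<le> norm x"
      using assms by (simp add: mult_left_le)
    then show "(1 - norm x)\<^sup>2 \<le> 1 - (norm x)\<^sup>2"
      by (simp add: power2_eq_square algebra_simps)
  qed
  then show "height_defect x \<le> norm x"
    by (simp add: height_defect_def)
  show "height_defect x = ((norm x)\<^sup>2 + (height_defect x)\<^sup>2) / 2"
    using le1 by (simp add: height_defect_def power2_diff)
qed

lemma height_defect_bigo:
  "(\<lambda>x::real^'n::finite. of_real (height_defect x) :: 'k::real_normed_field) \<in> O[nhds 0](\<lambda>x. of_real (norm x))"
proof (rule bigoI[where c = 1])
  have "\<bar>height_defect x\<bar> \<le> norm x" if "norm x < 1" for x :: "real^'n"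
    using height_defect(1,2)[of x] that by simp
  then show "\<forall>\<^sub>F x::real^'n in nhds 0. norm (of_real (height_defect x) :: 'k) \<le> 1 * norm (of_real (norm x) :: 'k)"
    by (auto simp: eventually_nhds_metric intro!: exI[of _ 1])
qed

text \<open>If p approximates the defect w, the new candidate \<open>(|x|^2 + p^2) / 2\<close> has
  error \<open>(w - p) * (w + p) / 2\<close>, and the factor w + p contributes one more order.
  Orders begin at 1 because this needs p to be O(|x|), which order 0 does not guarantee.\<close>

lemma poly_approx_height_defect:
  "poly_approx (Suc m) (\<lambda>x::real^'n::finite. of_real (height_defect x) :: 'k::real_normed_field)"
proof (induction m)
  case 0
  show ?case
    unfolding poly_approx_def
    by (intro exI[of _ 0] bexI[OF _ poly_space_const[of 0]]) (simp add: height_defect_bigo)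
next
  case (Suc m)
  let ?w = "\<lambda>x::real^'n. of_real (height_defect x) :: 'k"
  obtain M p where p: "p \<in> poly_space M" "(\<lambda>x. ?w x - p x) \<in> O[nhds 0](\<lambda>x. of_real (norm x ^ Suc m))"
    using Suc unfolding poly_approx_def by auto
  have "(\<lambda>x. ?w x - p x) \<in> O[nhds 0](\<lambda>x. of_real (norm x))"
    using landau_o.big_trans[OF p(2) bigo_norm_power_mono[of 1 "Suc m"]] by simp
  \<comment> \<open>Here w + p is read as (w + w) - (w - p).\<close>
  from sum_in_bigo(2)[OF sum_in_bigo(1)[OF height_defect_bigo height_defect_bigo] this]
  have "(\<lambda>x. ?w x + p x) \<in> O[nhds 0](\<lambda>x. of_real (norm x))"
    by (simp add: algebra_simps)
  from landau_o.big.mult[OF p(2) this]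
  have "(\<lambda>x. (?w x - p x) * (?w x + p x)) \<in> O[nhds 0](\<lambda>x. of_real (norm x ^ Suc (Suc m)))"
    by (simp add: mult_ac)
  then have "(\<lambda>x. 1/2 * ((?w x - p x) * (?w x + p x))) \<in> O[nhds 0](\<lambda>x. of_real (norm x ^ Suc (Suc m)))"
    by simp
  \<comment> \<open>The quadratic identity is available for \<open>norm x \<le> 1\<close>, which
    suffices near the origin.\<close>
  also have "?this \<longleftrightarrow> (\<lambda>x. ?w x - 1/2 * (of_real ((norm x)\<^sup>2) + p x * p x)) \<in> O[nhds 0](\<lambda>x. of_real (norm x ^ Suc (Suc m)))"
  proof (rule landau_o.big.in_cong)
    have "?w x = 1/2 * (of_real ((norm x)\<^sup>2) + ?w x * ?w x)" if "norm x \<le> 1" for x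
      by (subst height_defect(3)[OF that]) (simp add: power2_eq_square)
    then have "1/2 * ((?w x - p x) * (?w x + p x)) = ?w x - 1/2 * (of_real ((norm x)\<^sup>2) + p x * p x)" if "norm x \<le> 1" for x
      using that by (simp add: field_simps)
    then show "\<forall>\<^sub>F x in nhds 0. 1/2 * ((?w x - p x) * (?w x + p x)) = ?w x - 1/2 * (of_real ((norm x)\<^sup>2) + p x * p x)"
      by (auto simp: eventually_nhds_metric intro!: exI[of _ 1])
  qed
  finally have 1: "(\<lambda>x. ?w x - 1/2 * (of_real ((norm x)\<^sup>2) + p x * p x)) \<in> O[nhds 0](\<lambda>x. of_real (norm x ^ Suc (Suc m)))" .
  \<comment> \<open>The closure rules supply a polynomial \<open>q\<close> for the candidate up to
    the same order, without computing a degree.\<close>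
  have "poly_approx (Suc (Suc m)) (\<lambda>x::real^'n. 1/2 * (of_real ((norm x)\<^sup>2) + p x * p x))"
    by (intro poly_approx_mult poly_approx_add poly_approx_of_real_norm_sq
        poly_approx_poly[OF p(1)] poly_approx_poly[OF poly_space_const[of _ 0]])
  then obtain N q where q: "q \<in> poly_space N"
    "(\<lambda>x. 1/2 * (of_real ((norm x)\<^sup>2) + p x * p x) - q x) \<in> O[nhds 0](\<lambda>x. of_real (norm x ^ Suc (Suc m)))"
    unfolding poly_approx_def by auto
  from sum_in_bigo(1)[OF 1 q(2)] have "(\<lambda>x. ?w x - q x) \<in> O[nhds 0](\<lambda>x. of_real (norm x ^ Suc (Suc m)))"
    by simp
  with q(1) show ?case
    unfolding poly_approx_def by blast
qed

section \<open>Expansion in tangent coordinates\<close>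

text \<open>Isolates the non-polynomial part: any linear functional of the displacement is
  polynomial in \<open>x\<close> up to a multiple of \<open>height_defect x\<close>.\<close>

lemma inner_hemi_proj:
  fixes v :: "real^('n::finite option)"
  shows "(hemi_proj x - e_last) \<bullet> v = (\<Sum>i\<in>UNIV. x $ i * v $ Some i) - height_defect x * v $ None"
  by (simp add: inner_vec_def UNIV_option_conv sum.reindex hemi_proj_def e_last_def axis_def
      height_defect_def algebra_simps)

text \<open>Pythagoras with \<open>height_defect x \<le> norm x\<close>; it converts powers of the
  ambient displacement into powers of \<open>norm x\<close>.\<close>

lemma norm_hemi_proj_diff_le:
  assumes "norm x \<le> 1"
  shows "norm (hemi_proj x - e_last :: real^('n::finite option)) \<le> 2 * norm x"
proof -
  let ?v = "hemi_proj x - e_last :: real^('n option)"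
  have "hemi_proj_inv ?v = x" "?v $ None = - height_defect x"
    by (simp_all add: hemi_proj_inv_def hemi_proj_def e_last_def axis_def vec_eq_iff height_defect_def)
  then have "(norm ?v)\<^sup>2 = (norm x)\<^sup>2 + (height_defect x)\<^sup>2"
    using norm_option_sq[of ?v] by simp
  also have "\<dots> \<le> (norm x)\<^sup>2 + (norm x)\<^sup>2"
    using height_defect(1,2)[OF assms] by (intro add_mono power_mono) auto
  also have "\<dots> \<le> (2 * norm x)\<^sup>2"
    by (simp add: power2_eq_square)
  finally show ?thesis
    by (rule power2_le_imp_le) simp
qed

lemma rotation_matrix_isometry:
  fixes R :: "real^'n::finite^'n"
  assumes "rotation_matrix R"
  shows "(R *v u) \<bullet> (R *v v) = u \<bullet> v" "norm (R *v v) = norm v"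
proof -
  have "orthogonal_transformation ((*v) R)"
    using assms by (simp add: rotation_matrix_def orthogonal_transformation_matrix)
  then show "(R *v u) \<bullet> (R *v v) = u \<bullet> v" "norm (R *v v) = norm v"
    by (simp_all add: orthogonal_transformation_def norm_eq_sqrt_inner)
qed

text \<open>Moving \<open>R\<close> onto \<open>v\<close> by adjointness makes each linear factor a
  polynomial plus a multiple of \<open>height_defect\<close>; the closure rules do the rest.\<close>

lemma poly_approx_hom_poly:
  fixes P :: "real^('n::finite option) \<Rightarrow> 'k::real_normed_field"
    and R :: "real^('n option)^('n option)"
  assumes "hom_poly k P"
  shows "poly_approx (Suc m) (\<lambda>x. P (transpose R *v (hemi_proj x - e_last)))"
  using assms
proof induction
  case (hom_poly_inner k p v)
  have adj: "(transpose R *v u) \<bullet> v = u \<bullet> (R *v v)" for u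
    by (metis dot_lmul_matrix transpose_matrix_vector transpose_transpose)
  then have eq: "((transpose R *v (hemi_proj x - e_last)) \<bullet> v) *\<^sub>R z =
      ((\<Sum>i\<in>UNIV. of_real ((R *v v) $ Some i) * of_real (x $ i)) +
       of_real (- (R *v v) $ None) * of_real (height_defect x)) * z" for x :: "real^'n" and z :: 'k
    by (simp only: adj inner_hemi_proj scaleR_conv_of_real) (simp add: algebra_simps)
  show ?case
    unfolding eq
    by (intro poly_approx_mult poly_approx_add poly_approx_sum hom_poly_inner.IH
        poly_approx_height_defect poly_approx_poly[OF poly_space_coord]
        poly_approx_poly[OF poly_space_const[of _ 0]])
qed (auto intro: poly_approx_poly[OF poly_space_const[of _ 0]] poly_approx_add)

text \<open>Three errors of order \<open>L + 1\<close> add up: the Taylor remainder, the replacement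
  of \<open>height_defect\<close> by a polynomial, and the truncation. The condition
  \<open>0 < y \<bullet> z\<close> selects the hemisphere on which the tangent coordinate determines
  \<open>z\<close>.\<close>

lemma tangent_expansion:
  fixes f :: "real^('n::finite option) \<Rightarrow> 'k::real_normed_field"
  assumes "Ck_sphere (L + 1) f" "y \<in> sphere 0 1" "rotation_matrix R" "R *v y = e_last"
  shows "\<exists>p\<in>poly_space L. \<exists>C e. e > 0 \<and> C > 0 \<and> (\<forall>z\<in>sphere 0 1. norm (hemi_proj_inv (R *v z)) < e \<longrightarrow> 0 < y \<bullet> z \<longrightarrow>
    norm (f z - p (hemi_proj_inv (R *v z))) \<le> C * norm (hemi_proj_inv (R *v z)) ^ (L + 1))"
proof -
  define h :: "real^'n \<Rightarrow> real^('n option)" where "h x = transpose R *v (hemi_proj x - e_last)" for x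
  have RR: "transpose R *v (R *v z) = z" for z
    using assms(3) unfolding rotation_matrix_def orthogonal_matrix_def
    by (metis matrix_vector_mul_assoc matrix_vector_mul_lid)
  note iR = rotation_matrix_isometry(1)[OF assms(3)] and nR = rotation_matrix_isometry(2)[OF assms(3)]
  obtain U F where U: "open U" "y \<in> U" "Ck_on (Suc L) U F" "\<And>z. z \<in> U \<Longrightarrow> z \<in> sphere 0 1 \<Longrightarrow> F z = f z"
    using assms(1,2) unfolding Ck_sphere_def by fastforce
  obtain P where P: "\<And>k. hom_poly k (P k)"
    "(\<lambda>h. norm (F (y + h) - (\<Sum>k<Suc L. P k h))) \<in> O[nhds 0](\<lambda>h. norm h ^ Suc L)"
    using Ck_on_taylor[OF U(1-3)] by auto
  obtain K where K: "\<And>v. norm (transpose R *v v) \<le> norm v * K" "K > 0"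
    using bounded_linear.pos_bounded[OF matrix_vector_mul_bounded_linear] by metis
  have hle: "norm (h x) \<le> (2 * K) * norm x" if "norm x \<le> 1" for x
  proof -
    have "norm (h x) \<le> norm (hemi_proj x - e_last :: real^('n option)) * K"
      unfolding h_def by (rule K)
    also have "\<dots> \<le> 2 * norm x * K"
      using norm_hemi_proj_diff_le[OF that] K(2) by (intro mult_right_mono) auto
    finally show ?thesis by (simp add: mult_ac)
  qed
  have hO: "(\<lambda>x. norm (h x)) \<in> O[nhds 0](\<lambda>x. norm x)"
    using hle by (intro bigoI[where c = "2 * K"]) (auto simp: eventually_nhds_metric intro!: exI[of _ 1])
  \<comment> \<open>Composing the Taylor estimate with \<open>h\<close> needs convergence along the
    full filter \<open>nhds 0\<close>, origin included.\<close>
  have "(h \<longlongrightarrow> 0) (nhds 0)"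
  proof (rule Lim_null_comparison)
    show "\<forall>\<^sub>F x in nhds 0. norm (h x) \<le> (2 * K) * norm x"
      using hle by (auto simp: eventually_nhds_metric intro!: exI[of _ 1])
    have "((\<lambda>x::real^'n. (2 * K) * norm x) \<longlongrightarrow> (2 * K) * norm (0::real^'n)) (nhds 0)"
      by (intro tendsto_intros filterlim_ident)
    then show "((\<lambda>x::real^'n. (2 * K) * norm x) \<longlongrightarrow> 0) (nhds 0)" by simp
  qed
  then have lim: "filterlim h (nhds 0) (nhds 0)" .
  have "(\<lambda>x. norm (F (y + h x) - (\<Sum>k<Suc L. P k (h x)))) \<in> O[nhds 0](\<lambda>x. norm (h x) ^ Suc L)"
    by (rule landau_o.big.compose[OF P(2) lim])
  also have "(\<lambda>x. norm (h x) ^ Suc L) \<in> O[nhds 0](\<lambda>x. norm x ^ Suc L)"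
    by (rule landau_o.big_power[OF hO])
  finally have 1: "(\<lambda>x. F (y + h x) - (\<Sum>k<Suc L. P k (h x))) \<in> O[nhds 0](\<lambda>x. of_real (norm x ^ Suc L))"
    by (simp add: bigo_def norm_mult norm_power)
  have "poly_approx (Suc L) (\<lambda>x. \<Sum>k<Suc L. P k (h x))"
    unfolding h_def by (intro poly_approx_sum poly_approx_hom_poly[OF P(1)])
  then obtain M q where q: "q \<in> poly_space M"
    "(\<lambda>x. (\<Sum>k<Suc L. P k (h x)) - q x) \<in> O[nhds 0](\<lambda>x. of_real (norm x ^ Suc L))"
    unfolding poly_approx_def by auto
  obtain p where p: "p \<in> poly_space L" "(\<lambda>x. q x - p x) \<in> O[nhds 0](\<lambda>x. of_real (norm x ^ Suc L))"
    using poly_space_truncate[OF q(1)] by auto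
  have "(\<lambda>x. F (y + h x) - p x) \<in> O[nhds 0](\<lambda>x. of_real (norm x ^ Suc L))"
    using sum_in_bigo(1)[OF sum_in_bigo(1)[OF 1 q(2)] p(2)] by simp
  then obtain C where C: "C > 0" "\<forall>\<^sub>F x in nhds 0. norm (F (y + h x) - p x) \<le> C * norm x ^ Suc L"
    by (elim landau_o.bigE) (auto simp: norm_mult norm_power)
  \<comment> \<open>\<open>F\<close> is known to agree with \<open>f\<close> only on the part of the
    sphere in \<open>U\<close>, so the radius \<open>e\<close> must also keep \<open>y + h x\<close>
    inside \<open>U\<close>.\<close>
  have "((\<lambda>x. y + h x) \<longlongrightarrow> y + 0) (nhds 0)"
    by (intro tendsto_intros lim)
  then have "\<forall>\<^sub>F x in nhds 0. y + h x \<in> U"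
    using U by (intro topological_tendstoD) auto
  with C(2) have "\<forall>\<^sub>F x in nhds 0. norm (F (y + h x) - p x) \<le> C * norm x ^ Suc L \<and> y + h x \<in> U"
    by (rule eventually_conj)
  then obtain e where e: "e > 0"
    "\<And>x. norm x < e \<Longrightarrow> norm (F (y + h x) - p x) \<le> C * norm x ^ Suc L \<and> y + h x \<in> U"
    by (auto simp: eventually_nhds_metric)
  have "norm (f z - p (hemi_proj_inv (R *v z))) \<le> C * norm (hemi_proj_inv (R *v z)) ^ (L + 1)"
    if z: "z \<in> sphere 0 1" "norm (hemi_proj_inv (R *v z)) < e" "0 < y \<bullet> z" for z
  proof -
    define x where "x = hemi_proj_inv (R *v z)"
    \<comment> \<open>Since \<open>R *v y = e_last\<close>, the height of \<open>R *v z\<close>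
      above the equator is \<open>y \<bullet> z\<close>; positivity puts the unit vector
      \<open>R *v z\<close> in the range of \<open>hemi_proj\<close>.\<close>
    have "(R *v z) $ None = y \<bullet> z"
      using iR[of y z] assms(4) by (simp add: e_last_def inner_axis')
    then have "R *v z \<in> cap (pi/2) e_last"
      using z by (simp add: cap_pi_half nR)
    then obtain x' where "R *v z = hemi_proj x'"
      using bij_betw_hemi_proj(1) unfolding bij_betw_def by blast
    then have "hemi_proj x = R *v z"
      by (simp add: x_def bij_betw_hemi_proj(2))
    then have "h x = transpose R *v (R *v z) - transpose R *v (R *v y)"
      by (simp only: h_def assms(4) matrix_vector_mult_diff_distrib)
    then have "y + h x = z"
      by (simp only: RR) simp
    with e(2)[of x] U(4)[of z] z show ?thesis
      by (simp add: x_def)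
  qed
  with p(1) C(1) e(1) show ?thesis by blast
qed

section \<open>From the pointwise expansion to the error on spherical caps\<close>

text \<open>The norm of the tangent coordinate is the sine of the angle
  \<open>arccos (y \<bullet> z)\<close>, hence at most the angle itself. A radius of at most
  \<open>pi / 2\<close> keeps the cosine positive.\<close>

lemma cap_tangent_coord:
  fixes y z :: "real^('n::finite option)"
  assumes "y \<in> sphere 0 1" "rotation_matrix R" "R *v y = e_last" "z \<in> cap \<delta> y" "\<delta> \<le> pi / 2"
  shows "norm (hemi_proj_inv (R *v z)) < \<delta>" "0 < y \<bullet> z"
proof -
  have z: "norm z = 1" "arccos (y \<bullet> z) < \<delta>"
    using assms(4) by (auto simp: cap_def)
  note iR = rotation_matrix_isometry(1)[OF assms(2)] and nR = rotation_matrix_isometry(2)[OF assms(2)]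
  have yz: "\<bar>y \<bullet> z\<bar> \<le> 1"
    using Cauchy_Schwarz_ineq2[of y z] assms(1) z by simp
  have "arccos (y \<bullet> z) < arccos 0"
    using z assms(5) by simp
  then show "0 < y \<bullet> z"
    using yz by (subst (asm) arccos_less_mono) auto
  have last: "(R *v z) $ None = y \<bullet> z"
    using iR[of y z] assms(3) by (simp add: e_last_def inner_axis')
  have "(norm (hemi_proj_inv (R *v z)))\<^sup>2 = 1 - (y \<bullet> z)\<^sup>2"
    using norm_option_sq[of "R *v z"] by (simp add: last nR z)
  then have "norm (hemi_proj_inv (R *v z)) = sqrt (1 - (y \<bullet> z)\<^sup>2)"
    by (metis norm_ge_zero real_sqrt_unique)
  also have "\<dots> = sin (arccos (y \<bullet> z))"
    using yz by (intro sin_arccos[symmetric]) auto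
  also have "\<dots> \<le> arccos (y \<bullet> z)"
    using yz by (intro sin_x_le_x arccos_lbound) auto
  finally show "norm (hemi_proj_inv (R *v z)) < \<delta>"
    using z by simp
qed

text \<open>Testing with \<open>g0\<close> bounds the infimum from above. Real suprema and infima
  need bounded sets: \<open>f - g\<close> is bounded as \<open>(f - g0) + (g0 - g)\<close>, and the
  suprema are nonnegative because the cap is nonempty.\<close>

lemma best_approx_error_bound:
  assumes "g0 \<in> G" "cap \<delta> y \<noteq> {}"
    and g0: "\<And>z. z \<in> cap \<delta> y \<Longrightarrow> norm (f z - g0 z) \<le> B"
    and bdd: "\<And>g. g \<in> G \<Longrightarrow> bounded (g ` cap \<delta> y)"
  shows "\<bar>best_approx_error \<delta> G f y\<bar> \<le> B"
proof -
  obtain z0 where z0: "z0 \<in> cap \<delta> y"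
    using assms(2) by blast
  have bounds: "bdd_above ((\<lambda>z. norm (f z - g z)) ` cap \<delta> y)" if g: "g \<in> G" for g
  proof -
    obtain b c where bc: "\<And>z. z \<in> cap \<delta> y \<Longrightarrow> norm (g z) \<le> b" "\<And>z. z \<in> cap \<delta> y \<Longrightarrow> norm (g0 z) \<le> c"
      using bdd[OF g] bdd[OF assms(1)] unfolding bounded_iff by auto
    have "norm (f z - g z) \<le> B + (c + b)" if "z \<in> cap \<delta> y" for z
    proof -
      have "norm (f z - g z) \<le> norm (f z - g0 z) + norm (g0 z - g z)"
        using norm_triangle_ineq[of "f z - g0 z" "g0 z - g z"] by simp
      with g0[OF that] bc[OF that] norm_triangle_ineq4[of "g0 z" "g z"] show ?thesis
        by linarith
    qed
    then show ?thesis by (intro bdd_aboveI2)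
  qed
  have nonneg: "0 \<le> (SUP z\<in>cap \<delta> y. norm (f z - g z))" if "g \<in> G" for g
    by (rule order_trans[OF norm_ge_zero cSUP_upper[OF z0 bounds[OF that]]])
  have "best_approx_error \<delta> G f y \<le> (SUP z\<in>cap \<delta> y. norm (f z - g0 z))"
    unfolding best_approx_error_def
    by (intro cINF_lower assms(1) bdd_belowI2[where m = 0] nonneg)
  also have "\<dots> \<le> B"
    by (intro cSUP_least assms(2) g0)
  finally have "best_approx_error \<delta> G f y \<le> B" .
  moreover have "0 \<le> best_approx_error \<delta> G f y"
    unfolding best_approx_error_def using assms(1) by (intro cINF_greatest nonneg) auto
  ultimately show ?thesis by simp
qed

text \<open>A single \<open>p\<close> from \<open>tangent_expansion\<close> is tested on every small
  cap. The scalar field stays general to cover real and complex values at once.\<close>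

theorem best_approx_error_tangent_poly_space:
  fixes f :: "real^('n::finite option) \<Rightarrow> 'k::real_normed_field"
  assumes "Ck_sphere (L + 1) f" "y \<in> sphere 0 1" "rotation_matrix R" "R *v y = e_last"
  shows "(\<lambda>\<delta>. best_approx_error \<delta> (tangent_poly_space L R) f y) \<in> O[at_right 0](\<lambda>\<delta>. \<delta> ^ (L + 1))"
proof -
  obtain p C e where p: "p \<in> poly_space L" and Ce: "e > 0" "C > 0" and bound:
    "\<And>z. z \<in> sphere 0 1 \<Longrightarrow> norm (hemi_proj_inv (R *v z)) < e \<Longrightarrow> 0 < y \<bullet> z \<Longrightarrow>
      norm (f z - p (hemi_proj_inv (R *v z))) \<le> C * norm (hemi_proj_inv (R *v z)) ^ (L + 1)"
    using tangent_expansion[OF assms] by blast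
  \<comment> \<open>Below \<open>e\<close> the expansion is valid; below \<open>pi/2\<close> the cap
    lies in the hemisphere around \<open>y\<close>.\<close>
  have "\<bar>best_approx_error \<delta> (tangent_poly_space L R) f y\<bar> \<le> C * \<delta> ^ (L + 1)"
    if \<delta>: "0 < \<delta>" "\<delta> < min e (pi/2)" for \<delta>
  proof (rule best_approx_error_bound)
    show "p \<circ> hemi_proj_inv \<circ> (*v) R \<in> tangent_poly_space L R"
      unfolding tangent_poly_space_def using p by blast
    have "y \<in> cap \<delta> y"
      using assms(2) \<delta> by (simp add: cap_def dot_square_norm)
    then show "cap \<delta> y \<noteq> {}" by blast
  next
    fix z assume z: "z \<in> cap \<delta> y"
    have coord: "norm (hemi_proj_inv (R *v z)) < \<delta>" "0 < y \<bullet> z"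
      using cap_tangent_coord[OF assms(2-4) z] \<delta> by auto
    have "norm (f z - p (hemi_proj_inv (R *v z))) \<le> C * norm (hemi_proj_inv (R *v z)) ^ (L + 1)"
      using z coord \<delta> by (intro bound) (auto simp: cap_def)
    also have "\<dots> \<le> C * \<delta> ^ (L + 1)"
      using coord Ce by (intro mult_left_mono power_mono) auto
    finally show "norm (f z - (p \<circ> hemi_proj_inv \<circ> (*v) R) z) \<le> C * \<delta> ^ (L + 1)"
      by simp
  next
    fix g :: "real^('n option) \<Rightarrow> 'k" assume "g \<in> tangent_poly_space L R"
    then obtain q where q: "q \<in> poly_space L" "g = q \<circ> hemi_proj_inv \<circ> (*v) R"
      unfolding tangent_poly_space_def by blast
    \<comment> \<open>In tangent coordinates the cap lies in a compact ball, where \<open>q\<close>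
      is bounded by continuity.\<close>
    have "hemi_proj_inv (R *v z) \<in> cball 0 \<delta>" if "z \<in> cap \<delta> y" for z
      using cap_tangent_coord[OF assms(2-4) that] \<delta> by auto
    then have "g ` cap \<delta> y \<subseteq> q ` cball 0 \<delta>"
      unfolding q by auto
    then show "bounded (g ` cap \<delta> y)"
      using compact_continuous_image[OF continuous_on_poly_space[OF q(1)]]
      by (meson bounded_subset compact_cball compact_imp_bounded)
  qed
  then have "\<forall>\<^sub>F \<delta> in at_right 0. norm (best_approx_error \<delta> (tangent_poly_space L R) f y) \<le> C * norm (\<delta> ^ (L + 1))"
    unfolding eventually_at_right_field using Ce(1)
    by (intro exI[of _ "min e (pi/2)"]) (auto simp: abs_mult power_abs)
  then show ?thesis
    by (rule bigoI)
qed

text \<open>Two instances of the general estimate. Quantifying over all \<open>R\<close> that rotate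
  \<open>y\<close> to the pole covers every choice of the rotation.\<close>

theorem lemma5p2:
  fixes L :: nat
  shows "(\<forall>(f :: real^('n::finite option) \<Rightarrow> real) y R.
            Ck_sphere (L + 1) f \<longrightarrow> y \<in> sphere 0 1 \<longrightarrow>
            rotation_matrix R \<longrightarrow> R *v y = e_last \<longrightarrow>
            (\<lambda>\<delta>. best_approx_error \<delta> (tangent_poly_space L R) f y)
              \<in> O[at_right 0](\<lambda>\<delta>. \<delta> ^ (L + 1))) \<and>
         (\<forall>(f :: real^('n option) \<Rightarrow> complex) y R.
            Ck_sphere (L + 1) f \<longrightarrow> y \<in> sphere 0 1 \<longrightarrow>
            rotation_matrix R \<longrightarrow> R *v y = e_last \<longrightarrow>
            (\<lambda>\<delta>. best_approx_error \<delta> (tangent_poly_space L R) f y)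
              \<in> O[at_right 0](\<lambda>\<delta>. \<delta> ^ (L + 1)))"
  by (intro conjI allI impI) (rule best_approx_error_tangent_poly_space; assumption)+

end
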